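(* Let $V$ be a $p$-dimensional real inner product space, $\mathbf A=(A_1,\dots,A_q)\in\mathrm{End}(V)^q$, and let $T=(T_u:u\in\mathbb N(q))$ be the generalized Newton transformation of $\mathbf A$. Then $T_u=0$ for every $u\in\mathbb N(q)$ with $|u|\ge p$.
   Context: $\mathbb N=\{0,1,2,\dots\}$, $\mathbb N(q)$ is the set of multi-indices $u=(u_1,\dots,u_q)$ with $u_\alpha\in\mathbb N$, $|u|=\sum_\alpha u_\alpha$; $\alpha_\flat(u)$ is $u$ with $u_\alpha$ decreased by $1$. $\sigma_u=\sigma_u(\mathbf A)$ is defined by $\det(1_V+t_1A_1+\dots+t_qA_q)=\sum_{|u|\le p}\sigma_u t_1^{u_1}\cdots t_q^{u_q}$, and $\sigma_u=0$ if $|u|>p$ or $u$ has a negative entry. The generalized Newton transformation of $\mathbf A$ is the unique family $(T_u)_{u\in\mathbb N(q)}$ of endomorphisms of $V$ such that for every $u\in\mathbb N(q)$ and every smooth curve $\mathbf A(\tau)$ in $\mathrm{End}(V)^q$ with $\mathbf A(0)=\mathbf A$, $\frac{d}{d\tau}|_{\tau=0}\sigma_u(\mathbf A(\tau))=\sum_{\alpha=1}^q\mathrm{tr}(A_\alpha'(0)T_{\alpha_\flat(u)})$, with $T_w:=0$ if $w$ has a negative entry. Explicitly, $T_u=\sum_{s=0}^{|u|}\sum_{\alpha_1,\dots,\alpha_s=1}^q(-1)^s\sigma_{(\alpha_1)_\flat\cdots(\alpha_s)_\flat(u)}A_{\alpha_1}\cdots A_{\alpha_s}$. *)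

theory Defs
  imports "HOL-Analysis.Analysis"
begin

(* The determinant of the matrix of f with respect to the orthonormal basis Basis;
   the library's det is only available for matrices with a type-indexed dimension. *)
definition endo_det :: "('a::euclidean_space \<Rightarrow>\<^sub>L 'a) \<Rightarrow> real" where
  "endo_det f = (\<Sum>\<pi> | \<pi> permutes (Basis :: 'a set).
      of_int (sign \<pi>) * (\<Prod>b\<in>Basis. blinfun_apply f (\<pi> b) \<bullet> b))"

definition endo_tr :: "('a::euclidean_space \<Rightarrow>\<^sub>L 'a) \<Rightarrow> real" where
  "endo_tr f = (\<Sum>b\<in>Basis. blinfun_apply f b \<bullet> b)"

lemma endo_det_cart: "endo_det f = det (matrix (blinfun_apply f))"
  for f :: "(real^'n) \<Rightarrow>\<^sub>L (real^'n)"
proof -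
  let ?e = "\<lambda>i. axis i 1 :: real^'n"
  have bij: "bij_betw ?e UNIV Basis"
    by (auto simp: bij_betw_def inj_on_def Basis_vec_def axis_eq_axis)
  then have inj: "inj ?e" by (simp add: bij_betw_def)
  let ?P = "map_permutation UNIV ?e" and ?Q = "map_permutation Basis (inv ?e)"
  have term_eq: "of_int (sign (?P p)) * (\<Prod>b\<in>Basis. blinfun_apply f (?P p b) \<bullet> b) =
      of_int (sign p) * (\<Prod>i\<in>UNIV. matrix (blinfun_apply f) $ i $ p i)"
    if p: "p permutes UNIV" for p
  proof -
    have "(\<Prod>b\<in>Basis. blinfun_apply f (?P p b) \<bullet> b) =
        (\<Prod>i\<in>UNIV. blinfun_apply f (?P p (?e i)) \<bullet> ?e i)"
      using prod.reindex_bij_betw[OF bij] by (rule sym)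
    also have "\<dots> = (\<Prod>i\<in>UNIV. matrix (blinfun_apply f) $ i $ p i)"
      by (simp add: map_permutation_apply[OF inj] matrix_def inner_axis)
    finally show ?thesis using sign_map_permutation[OF inj p] by simp
  qed
  have bij': "bij_betw (inv ?e) Basis UNIV"
    using bij_betw_inv_into[OF bij] .
  have "(\<Sum>p | p permutes (UNIV :: 'n set).
        of_int (sign p) * (\<Prod>i\<in>UNIV. matrix (blinfun_apply f) $ i $ p i)) = endo_det f"
    unfolding endo_det_def
  proof (rule sum.reindex_bij_witness[where i = ?Q and j = ?P])
    fix p :: "'n \<Rightarrow> 'n" assume "p \<in> {p. p permutes UNIV}"
    then show "?Q (?P p) = p" "?P p \<in> {\<pi>. \<pi> permutes Basis}"
      using map_permutation_compose_inv[OF bij, of p "inv ?e"] map_permutation_permutes[OF bij]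
      by (simp_all add: inv_f_f[OF inj])
  next
    fix \<pi> :: "real^'n \<Rightarrow> real^'n" assume "\<pi> \<in> {\<pi>. \<pi> permutes Basis}"
    then show "?P (?Q \<pi>) = \<pi>" "?Q \<pi> \<in> {p. p permutes UNIV}"
      using map_permutation_compose_inv[OF bij', of \<pi> ?e] map_permutation_permutes[OF bij']
        bij_betw_inv_into_right[OF bij] by simp_all
  qed (simp add: term_eq)
  then show ?thesis by (simp add: det_def)
qed

lemma endo_tr_cart: "endo_tr f = trace (matrix (blinfun_apply f))"
  for f :: "(real^'n) \<Rightarrow>\<^sub>L (real^'n)"
proof -
  let ?e = "\<lambda>i. axis i 1 :: real^'n"
  have bij: "bij_betw ?e UNIV Basis"
    by (auto simp: bij_betw_def inj_on_def Basis_vec_def axis_eq_axis)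
  show ?thesis
    unfolding endo_tr_def trace_def sum.reindex_bij_betw[OF bij, symmetric]
    by (simp add: matrix_def inner_axis)
qed

type_synonym 'q multi_index = "'q \<Rightarrow> nat"

definition mi_abs :: "'q::finite multi_index \<Rightarrow> nat" where
  "mi_abs u = (\<Sum>\<alpha>\<in>UNIV. u \<alpha>)"

(* s is the coefficient family of det(1 + t_1 A_1 + ... + t_q A_q), extended by zero
   to the multi-indices of size greater than p = DIM('a). *)
definition is_sigma :: "('a::euclidean_space \<Rightarrow>\<^sub>L 'a)^'q \<Rightarrow> ('q multi_index \<Rightarrow> real) \<Rightarrow> bool" where
  "is_sigma A s \<longleftrightarrow>
     (\<forall>t :: 'q \<Rightarrow> real. endo_det (id_blinfun + (\<Sum>\<alpha>\<in>UNIV. t \<alpha> *\<^sub>R A $ \<alpha>)) =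
        (\<Sum>u | mi_abs u \<le> DIM('a). s u * (\<Prod>\<alpha>\<in>UNIV. t \<alpha> ^ u \<alpha>))) \<and>
     (\<forall>u. mi_abs u > DIM('a) \<longrightarrow> s u = 0)"

definition sigma :: "('a::euclidean_space \<Rightarrow>\<^sub>L 'a)^'q \<Rightarrow> 'q multi_index \<Rightarrow> real" where
  "sigma A = (THE s. is_sigma A s)"

(* The following lemmas lead to ex1_is_sigma: the definite description is well defined. *)
lemma finite_mi: "finite {u :: 'q::finite multi_index. mi_abs u \<le> n}"
proof (rule finite_subset)
  show "{u :: 'q multi_index. mi_abs u \<le> n} \<subseteq> PiE UNIV (\<lambda>_. {..n})"
  proof
    fix u :: "'q multi_index" assume u: "u \<in> {u. mi_abs u \<le> n}"
    have "u \<alpha> \<le> n" for \<alpha>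
    proof -
      have "u \<alpha> \<le> mi_abs u" unfolding mi_abs_def by (rule member_le_sum) auto
      with u show ?thesis by simp
    qed
    then show "u \<in> PiE UNIV (\<lambda>_. {..n})" by (simp add: PiE_UNIV_domain)
  qed
qed (intro finite_PiE; simp)

lemma multi_poly_zero:
  fixes c :: "('q \<Rightarrow> nat) \<Rightarrow> real"
  assumes "finite S" "finite U" "inj_on (\<lambda>u. restrict u S) U"
    and "\<And>t :: 'q \<Rightarrow> real. (\<Sum>u\<in>U. c u * (\<Prod>\<alpha>\<in>S. t \<alpha> ^ u \<alpha>)) = 0"
    and "u \<in> U"
  shows "c u = 0"
  using assms
proof (induction S arbitrary: U u rule: finite_induct)
  case empty
  then have "U = {u}" by (auto simp: inj_on_def)
  with empty.prems(3)[of undefined] show ?case by simp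
next
  case (insert \<beta> S)
  define N where "N = Max ((\<lambda>u. u \<beta>) ` U)"
  have N: "v \<beta> \<le> N" if "v \<in> U" for v using that insert.prems(1) by (simp add: N_def)
  define U' where "U' k = {v \<in> U. v \<beta> = k}" for k
  have inner: "(\<Sum>v\<in>U' k. c v * (\<Prod>\<alpha>\<in>S. t \<alpha> ^ v \<alpha>)) = 0" for k t
  proof (cases "k \<le> N")
    case False
    then have "U' k = {}" using N by (auto simp: U'_def)
    then show ?thesis by simp
  next
    case True
    define d where "d k = (\<Sum>v\<in>U' k. c v * (\<Prod>\<alpha>\<in>S. t \<alpha> ^ v \<alpha>))" for k
    have "(\<Sum>k\<le>N. d k * x ^ k) = 0" for x :: real
    proof -
      have pS: "(\<Prod>\<alpha>\<in>S. (t(\<beta> := x)) \<alpha> ^ v \<alpha>) = (\<Prod>\<alpha>\<in>S. t \<alpha> ^ v \<alpha>)" for v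
        using insert.hyps(2) by (intro prod.cong) auto
      have "0 = (\<Sum>v\<in>U. c v * (\<Prod>\<alpha>\<in>insert \<beta> S. (t(\<beta> := x)) \<alpha> ^ v \<alpha>))"
        by (rule insert.prems(3)[symmetric])
      also have "\<dots> = (\<Sum>v\<in>U. c v * (\<Prod>\<alpha>\<in>S. t \<alpha> ^ v \<alpha>) * x ^ v \<beta>)"
        using insert.hyps pS by (intro sum.cong) (auto simp: mult_ac)
      also have "\<dots> = (\<Sum>k\<le>N. \<Sum>v\<in>{v \<in> U. v \<beta> = k}. c v * (\<Prod>\<alpha>\<in>S. t \<alpha> ^ v \<alpha>) * x ^ v \<beta>)"
        using N insert.prems(1) by (intro sum.group[symmetric]) auto
      also have "\<dots> = (\<Sum>k\<le>N. d k * x ^ k)"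
        unfolding d_def U'_def sum_distrib_right by (intro sum.cong) auto
      finally show ?thesis by simp
    qed
    then have "d k = 0" using True polyfun_eq_0[of d N] by blast
    then show ?thesis by (simp add: d_def)
  qed
  have "finite (U' (u \<beta>))" using insert.prems(1) by (simp add: U'_def)
  moreover have "inj_on (\<lambda>u. restrict u S) (U' (u \<beta>))"
  proof (rule inj_onI)
    fix v w assume vw: "v \<in> U' (u \<beta>)" "w \<in> U' (u \<beta>)" "restrict v S = restrict w S"
    then have "\<alpha> \<in> insert \<beta> S \<Longrightarrow> v \<alpha> = w \<alpha>" for \<alpha>
      by (metis (mono_tags, lifting) U'_def insertE mem_Collect_eq restrict_apply')
    then have "restrict v (insert \<beta> S) = restrict w (insert \<beta> S)" by (auto simp: restrict_def)
    moreover have "v \<in> U" "w \<in> U" using vw by (auto simp: U'_def)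
    ultimately show "v = w" using inj_onD[OF insert.prems(2)] by blast
  qed
  ultimately show ?case
    by (rule insert.IH) (use inner insert.prems(4) in \<open>simp_all add: U'_def\<close>)
qed

definition poly_le :: "nat \<Rightarrow> (('q::finite \<Rightarrow> real) \<Rightarrow> real) \<Rightarrow> bool" where
  "poly_le n f \<longleftrightarrow> (\<exists>c. \<forall>t. f t = (\<Sum>u | mi_abs u \<le> n. c u * (\<Prod>\<alpha>\<in>UNIV. t \<alpha> ^ u \<alpha>)))"

lemma poly_leI:
  fixes f :: "('q::finite \<Rightarrow> real) \<Rightarrow> real"
  assumes "finite I" "\<And>i. i \<in> I \<Longrightarrow> mi_abs (w i) \<le> n"
    "\<And>t. f t = (\<Sum>i\<in>I. d i * (\<Prod>\<alpha>\<in>UNIV. t \<alpha> ^ w i \<alpha>))"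
  shows "poly_le n f"
  unfolding poly_le_def
proof (intro exI allI)
  fix t
  have "f t = (\<Sum>u | mi_abs u \<le> n. \<Sum>i | i \<in> I \<and> w i = u. d i * (\<Prod>\<alpha>\<in>UNIV. t \<alpha> ^ w i \<alpha>))"
    unfolding assms(3) using assms(1,2) finite_mi by (intro sum.group[symmetric]) auto
  also have "\<dots> = (\<Sum>u | mi_abs u \<le> n. (\<Sum>i | i \<in> I \<and> w i = u. d i) * (\<Prod>\<alpha>\<in>UNIV. t \<alpha> ^ u \<alpha>))"
    by (simp add: sum_distrib_right)
  finally show "f t = (\<Sum>u | mi_abs u \<le> n. (\<Sum>i | i \<in> I \<and> w i = u. d i) * (\<Prod>\<alpha>\<in>UNIV. t \<alpha> ^ u \<alpha>))" .
qed

lemma poly_le_sum: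
  assumes "\<And>i. i \<in> I \<Longrightarrow> poly_le n (f i)"
  shows "poly_le n (\<lambda>t. \<Sum>i\<in>I. f i t)"
proof -
  have "\<forall>i. \<exists>c. i \<in> I \<longrightarrow>
      (\<forall>t. f i t = (\<Sum>u | mi_abs u \<le> n. c u * (\<Prod>\<alpha>\<in>UNIV. t \<alpha> ^ u \<alpha>)))"
  proof
    fix i
    show "\<exists>c. i \<in> I \<longrightarrow> (\<forall>t. f i t = (\<Sum>u | mi_abs u \<le> n. c u * (\<Prod>\<alpha>\<in>UNIV. t \<alpha> ^ u \<alpha>)))"
      using assms[of i] unfolding poly_le_def by (cases "i \<in> I") simp_all
  qed
  from choice[OF this] obtain c where c: "\<forall>i. i \<in> I \<longrightarrow>
      (\<forall>t. f i t = (\<Sum>u | mi_abs u \<le> n. c i u * (\<Prod>\<alpha>\<in>UNIV. t \<alpha> ^ u \<alpha>)))" ..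
  have "(\<Sum>i\<in>I. f i t) = (\<Sum>u | mi_abs u \<le> n. (\<Sum>i\<in>I. c i u) * (\<Prod>\<alpha>\<in>UNIV. t \<alpha> ^ u \<alpha>))" for t
  proof -
    have "(\<Sum>i\<in>I. f i t) = (\<Sum>i\<in>I. (\<Sum>u | mi_abs u \<le> n. c i u * (\<Prod>\<alpha>\<in>UNIV. t \<alpha> ^ u \<alpha>)))"
      using c by (intro sum.cong) auto
    also have "\<dots> = (\<Sum>u | mi_abs u \<le> n. \<Sum>i\<in>I. c i u * (\<Prod>\<alpha>\<in>UNIV. t \<alpha> ^ u \<alpha>))"
      by (rule sum.swap)
    finally show ?thesis by (simp add: sum_distrib_right)
  qed
  then show ?thesis unfolding poly_le_def by (intro exI[of _ "\<lambda>u. \<Sum>i\<in>I. c i u"]) simp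
qed

lemma poly_le_mult:
  fixes f g :: "('q::finite \<Rightarrow> real) \<Rightarrow> real"
  assumes "poly_le m f" "poly_le n g"
  shows "poly_le (m + n) (\<lambda>t. f t * g t)"
proof -
  from assms(1) obtain c where "\<forall>t. f t = (\<Sum>u | mi_abs u \<le> m. c u * (\<Prod>\<alpha>\<in>UNIV. t \<alpha> ^ u \<alpha>))"
    unfolding poly_le_def ..
  then have c: "f t = (\<Sum>u | mi_abs u \<le> m. c u * (\<Prod>\<alpha>\<in>UNIV. t \<alpha> ^ u \<alpha>))" for t ..
  from assms(2) obtain d where "\<forall>t. g t = (\<Sum>u | mi_abs u \<le> n. d u * (\<Prod>\<alpha>\<in>UNIV. t \<alpha> ^ u \<alpha>))"
    unfolding poly_le_def ..
  then have d: "g t = (\<Sum>u | mi_abs u \<le> n. d u * (\<Prod>\<alpha>\<in>UNIV. t \<alpha> ^ u \<alpha>))" for t ..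
  show ?thesis
  proof (rule poly_leI[where I = "{u. mi_abs u \<le> m} \<times> {u. mi_abs u \<le> n}"
        and w = "\<lambda>(u, v) \<alpha>. u \<alpha> + v \<alpha>" and d = "\<lambda>(u, v). c u * d v"])
    fix t
    show "f t * g t = (\<Sum>i\<in>{u. mi_abs u \<le> m} \<times> {u. mi_abs u \<le> n}.
        (case i of (u, v) \<Rightarrow> c u * d v) * (\<Prod>\<alpha>\<in>UNIV. t \<alpha> ^ (case i of (u, v) \<Rightarrow> \<lambda>\<alpha>. u \<alpha> + v \<alpha>) \<alpha>))"
      unfolding c d sum_product sum.cartesian_product
      by (intro sum.cong) (auto simp: power_add prod.distrib)
    show "finite ({u :: 'q multi_index. mi_abs u \<le> m} \<times> {u :: 'q multi_index. mi_abs u \<le> n})"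
      by (intro finite_cartesian_product finite_mi)
  qed (auto simp: mi_abs_def sum.distrib intro: add_mono)
qed

lemma poly_le_const: "poly_le n (\<lambda>t. k)"
  by (rule poly_leI[where I = "{()}" and w = "\<lambda>_ _. 0" and d = "\<lambda>_. k"]) (auto simp: mi_abs_def)

lemma poly_le_var: "poly_le 1 (\<lambda>t. t \<alpha>)"
  by (rule poly_leI[where I = "{()}" and w = "\<lambda>_ \<beta>. if \<beta> = \<alpha> then 1 else 0" and d = "\<lambda>_. 1"])
    (auto simp: mi_abs_def if_distrib[of "\<lambda>n. _ ^ n"] cong: if_cong)

lemma poly_le_prod:
  assumes "finite I" "\<And>i. i \<in> I \<Longrightarrow> poly_le 1 (f i)"
  shows "poly_le (card I) (\<lambda>t. \<Prod>i\<in>I. f i t)"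
  using assms
proof (induction I rule: finite_induct)
  case empty
  show ?case by (simp add: poly_le_const)
next
  case (insert i I)
  show ?case using poly_le_mult[of 1 "f i" "card I"] insert by simp
qed

lemma ex1_is_sigma: "\<exists>!s. is_sigma A s" for A :: "('a::euclidean_space \<Rightarrow>\<^sub>L 'a)^'q"
proof -
  have lin: "poly_le 1 (\<lambda>t. blinfun_apply (id_blinfun + (\<Sum>\<alpha>\<in>UNIV. t \<alpha> *\<^sub>R A $ \<alpha>)) x \<bullet> y)" for x y
  proof -
    have "poly_le 1 (\<lambda>t. (\<Sum>i\<in>{0,1::nat}. if i = 0 then x \<bullet> y else
        (\<Sum>\<alpha>\<in>UNIV. t \<alpha> * (blinfun_apply (A $ \<alpha>) x \<bullet> y))))"
    proof (rule poly_le_sum)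
      fix i :: nat
      have "poly_le (1 + 0) (\<lambda>t. t \<alpha> * (blinfun_apply (A $ \<alpha>) x \<bullet> y))" for \<alpha>
        by (intro poly_le_mult poly_le_var poly_le_const)
      then show "poly_le 1 (\<lambda>t. if i = 0 then x \<bullet> y else
          (\<Sum>\<alpha>\<in>UNIV. t \<alpha> * (blinfun_apply (A $ \<alpha>) x \<bullet> y)))"
        by (cases "i = 0") (auto intro!: poly_le_const poly_le_sum)
    qed
    then show ?thesis
      by (simp add: blinfun.add_left blinfun.sum_left blinfun.scaleR_left inner_add_left
          inner_sum_left)
  qed
  have "poly_le DIM('a) (\<lambda>t. endo_det (id_blinfun + (\<Sum>\<alpha>\<in>UNIV. t \<alpha> *\<^sub>R A $ \<alpha>)))"
    unfolding endo_det_def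
  proof (rule poly_le_sum)
    fix \<pi> :: "'a \<Rightarrow> 'a"
    have "poly_le (0 + DIM('a)) (\<lambda>t. of_int (sign \<pi>) *
        (\<Prod>b\<in>Basis. blinfun_apply (id_blinfun + (\<Sum>\<alpha>\<in>UNIV. t \<alpha> *\<^sub>R A $ \<alpha>)) (\<pi> b) \<bullet> b))"
      by (intro poly_le_mult poly_le_const poly_le_prod lin) simp
    then show "poly_le DIM('a) (\<lambda>t. of_int (sign \<pi>) *
        (\<Prod>b\<in>Basis. blinfun_apply (id_blinfun + (\<Sum>\<alpha>\<in>UNIV. t \<alpha> *\<^sub>R A $ \<alpha>)) (\<pi> b) \<bullet> b))"
      by simp
  qed
  then obtain c where c: "\<And>t. endo_det (id_blinfun + (\<Sum>\<alpha>\<in>UNIV. t \<alpha> *\<^sub>R A $ \<alpha>)) =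
      (\<Sum>u | mi_abs u \<le> DIM('a). c u * (\<Prod>\<alpha>\<in>UNIV. t \<alpha> ^ u \<alpha>))"
    unfolding poly_le_def by blast
  have "is_sigma A (\<lambda>u. if mi_abs u \<le> DIM('a) then c u else 0)"
    unfolding is_sigma_def c by (auto intro!: sum.cong)
  moreover have "s = s'" if s: "is_sigma A s" "is_sigma A s'" for s s'
  proof
    fix u
    show "s u = s' u"
    proof (cases "mi_abs u \<le> DIM('a)")
      case True
      have "s u - s' u = 0"
      proof (rule multi_poly_zero[where S = UNIV and U = "{u. mi_abs u \<le> DIM('a)}"
            and c = "\<lambda>u. s u - s' u"])
        show "(\<Sum>u | mi_abs u \<le> DIM('a). (s u - s' u) * (\<Prod>\<alpha>\<in>UNIV. t \<alpha> ^ u \<alpha>)) = 0" for t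
          using s unfolding is_sigma_def by (simp add: left_diff_distrib sum_subtractf)
      qed (use True finite_mi in \<open>auto simp: inj_on_def restrict_UNIV\<close>)
      then show ?thesis by simp
    next
      case False
      then show ?thesis using s by (simp add: is_sigma_def)
    qed
  qed
  ultimately show ?thesis by blast
qed

(* Smooth means infinitely differentiable: D n is the n-th derivative of c. *)
definition smooth_curve :: "(real \<Rightarrow> 'b::real_normed_vector) \<Rightarrow> bool" where
  "smooth_curve c \<longleftrightarrow> (\<exists>D :: nat \<Rightarrow> real \<Rightarrow> 'b. D 0 = c \<and>
     (\<forall>n t. (D n has_vector_derivative D (Suc n) t) (at t)))"

(* at_flat T \<alpha> u is the member of the family T at u with its entry at \<alpha> decreased by one,
   and 0 if this makes the entry negative (on nat the subtraction would truncate). *)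
definition at_flat :: "('q multi_index \<Rightarrow> 'b::zero) \<Rightarrow> 'q \<Rightarrow> 'q multi_index \<Rightarrow> 'b" where
  "at_flat T \<alpha> u = (if u \<alpha> = 0 then 0 else T (u(\<alpha> := u \<alpha> - 1)))"

(* The derivative of the curve at 0 lives in the normed space End(V)^q, so its \<alpha>-th component
   is the derivative of the \<alpha>-th endomorphism. *)
definition is_gen_newton ::
  "('a::euclidean_space \<Rightarrow>\<^sub>L 'a)^'q \<Rightarrow> ('q multi_index \<Rightarrow> 'a \<Rightarrow>\<^sub>L 'a) \<Rightarrow> bool" where
  "is_gen_newton A T \<longleftrightarrow>
     (\<forall>u c. smooth_curve c \<and> c 0 = A \<longrightarrow>
        ((\<lambda>\<tau>. sigma (c \<tau>) u) has_real_derivative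
           (\<Sum>\<alpha>\<in>UNIV. endo_tr (vector_derivative c (at 0) $ \<alpha> o\<^sub>L at_flat T \<alpha> u))) (at 0))"

end

theory Submission
  imports Defs
begin

text \<open>
  The function \<open>\<sigma>\<^sub>v\<close> is identically zero once \<open>|v| > p\<close>, so its derivative vanishes along every
  curve. If \<open>|u| \<ge> p\<close>, raising a single entry \<open>u\<^sub>\<alpha>\<close> by one gives such an index \<open>v\<close> with
  \<open>\<alpha>\<^sub>\<flat>(v) = u\<close>. Along the straight line that moves only the \<open>\<alpha>\<close>-th endomorphism, in an
  arbitrary direction \<open>B\<close>, the variational identity at \<open>v\<close> keeps a single term and reads
  \<open>0 = tr (B T\<^sub>u)\<close>. The trace form is nondegenerate, as testing against rank-one maps shows, and
  therefore \<open>T\<^sub>u = 0\<close>.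
\<close>

lemma sigma_eq_0:
  fixes A :: "('a::euclidean_space \<Rightarrow>\<^sub>L 'a)^'q"
  assumes "mi_abs u > DIM('a)"
  shows "sigma A u = 0"
proof -
  have "is_sigma A (sigma A)"
    unfolding sigma_def by (rule theI'[OF ex1_is_sigma])
  with assms show ?thesis
    by (simp add: is_sigma_def)
qed

lemma line_has_vector_derivative:
  "((\<lambda>\<tau>. A + \<tau> *\<^sub>R H) has_vector_derivative H) (at t)"
  by (auto intro!: derivative_eq_intros)

lemma smooth_curve_line: "smooth_curve (\<lambda>\<tau>. A + \<tau> *\<^sub>R H)"
proof -
  let ?D = "\<lambda>n::nat. if n = 0 then (\<lambda>\<tau>. A + \<tau> *\<^sub>R H) else if n = 1 then (\<lambda>_. H) else (\<lambda>_. 0)"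
  have "(?D n has_vector_derivative ?D (Suc n) t) (at t)" for n t
    by (cases "n = 0") (simp_all add: line_has_vector_derivative)
  then show ?thesis
    unfolding smooth_curve_def by (intro exI[of _ ?D]) simp
qed

text \<open>Nondegeneracy of the trace form: for the rank-one map \<open>B x = (x \<bullet> a) b\<close> the trace of
  \<open>B S\<close> is the matrix entry \<open>S b \<bullet> a\<close>.\<close>

lemma endo_tr_compose_eq_0_imp_eq_0:
  fixes S :: "'a::euclidean_space \<Rightarrow>\<^sub>L 'a"
  assumes "\<And>B. endo_tr (B o\<^sub>L S) = 0"
  shows "S = 0"
proof (rule blinfun_eqI)
  fix b
  have "S b \<bullet> a = 0" for a
  proof -
    have "S b \<bullet> a = S (\<Sum>i\<in>Basis. (b \<bullet> i) *\<^sub>R i) \<bullet> a"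
      by (simp add: euclidean_representation)
    also have "\<dots> = endo_tr ((blinfun_scaleR_left b o\<^sub>L blinfun_inner_left a) o\<^sub>L S)"
      by (simp add: endo_tr_def blinfun.sum_right blinfun.scaleR_right inner_sum_left inner_sum_right
          inner_commute mult.commute)
    finally show ?thesis
      using assms by simp
  qed
  then show "S b = blinfun_apply 0 b"
    by (metis inner_eq_zero_iff zero_blinfun.rep_eq)
qed

theorem theorem3p1:
  fixes A :: "('a::euclidean_space \<Rightarrow>\<^sub>L 'a)^'q"
    and T :: "'q multi_index \<Rightarrow> 'a \<Rightarrow>\<^sub>L 'a"
    and u :: "'q multi_index"
  assumes "is_gen_newton A T"
    and "mi_abs u \<ge> DIM('a)"
  shows "T u = 0"
proof (rule endo_tr_compose_eq_0_imp_eq_0)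
  fix B :: "'a \<Rightarrow>\<^sub>L 'a"
  fix \<alpha> :: 'q
  define v where "v = u(\<alpha> := Suc (u \<alpha>))"
  have "mi_abs u < mi_abs v"
    unfolding mi_abs_def v_def by (rule sum_strict_mono_ex1) auto
  then have v: "mi_abs v > DIM('a)"
    using assms(2) by simp
  define c where "c = (\<lambda>\<tau>. A + \<tau> *\<^sub>R axis \<alpha> B)"
  have c': "vector_derivative c (at 0) = axis \<alpha> B"
    unfolding c_def by (rule vector_derivative_at[OF line_has_vector_derivative])
  have "smooth_curve c \<and> c 0 = A"
    by (simp add: c_def smooth_curve_line)
  then have "((\<lambda>\<tau>. sigma (c \<tau>) v) has_real_derivative
      (\<Sum>\<beta>\<in>UNIV. endo_tr (axis \<alpha> B $ \<beta> o\<^sub>L at_flat T \<beta> v))) (at 0)"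
    using assms(1) unfolding is_gen_newton_def c'[symmetric] by blast
  moreover have "((\<lambda>\<tau>. sigma (c \<tau>) v) has_real_derivative 0) (at 0)"
    by (simp add: sigma_eq_0[OF v])
  ultimately have "0 = (\<Sum>\<beta>\<in>UNIV. endo_tr (axis \<alpha> B $ \<beta> o\<^sub>L at_flat T \<beta> v))"
    by (metis DERIV_unique)
  also have "\<dots> = (\<Sum>\<beta>\<in>UNIV. if \<beta> = \<alpha> then endo_tr (B o\<^sub>L T u) else 0)"
    by (intro sum.cong) (auto simp: axis_def at_flat_def v_def endo_tr_def)
  finally show "endo_tr (B o\<^sub>L T u) = 0"
    by simp
qed

end
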